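(* Let $U\subset\mathbb{R}^V$ be a linear space of graph signals. Then $U$ is shift-invariant if and only if $U$, equipped with the standard inner product of $\mathbb{R}^V$, is a shift-invariant graph reproducing kernel Hilbert space (SIGRKHS).
   Context: Let $\mathcal{G}=(V,E,\mathbf{W})$ be a finite, simple, undirected graph with $N\ge 2$ vertices. A graph signal is a vector $\mathbf{x}=[x(v)]_{v\in V}\in\mathbb{R}^V$. A graph shift is a matrix $\mathbf{S}=[s(i,j)]_{i,j\in V}$ with $s(i,j)=0$ unless $i=j$ or $(i,j)\in E$. Standing assumption: $\mathbf{S}_1,\ldots,\mathbf{S}_d$ are graph shifts that are real-valued, symmetric and pairwise commuting. A linear space $U$ of graph signals is shift-invariant if $\mathbf{S}_l\mathbf{x}\in U$ for all $1\le l\le d$ and $\mathbf{x}\in U$. A graph reproducing kernel Hilbert space (GRKHS) is a Hilbert space $H$ of graph signals (a linear subspace of $\mathbb{R}^V$ with an inner product $\langle\cdot,\cdot\rangle_H$ and norm $\|\cdot\|_H$) such that for every $v\in V$ there is a constant $C_v>0$ with $|x(v)|\le C_v\|\mathbf{x}\|_H$ for all $\mathbf{x}\in H$. Its reproducing kernel is the matrix $\mathbf{K}=[K(v,v')]_{v,v'\in V}$ whose columns $K(\cdot,v)$ lie in $H$ and satisfy $x(v)=\langle\mathbf{x},K(\cdot,v)\rangle_H$ for all $\mathbf{x}\in H$, $v\in V$; one has $H=\{\mathbf{K}\mathbf{c}:\mathbf{c}\in\mathbb{R}^V\}$. An SIGRKHS is a GRKHS whose reproducing kernel satisfies $\mathbf{K}\mathbf{S}_l=\mathbf{S}_l\mathbf{K}$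 for all $1\le l\le d$. *)

theory Defs
  imports "HOL-Analysis.Analysis"
begin

text \<open>
  The vertex set is the finite type \<open>'v\<close>, so graph signals are vectors in \<open>real ^ 'v\<close> and matrices
  over the vertices are elements of \<open>real ^ 'v ^ 'v\<close>. An undirected edge between \<open>i\<close> and \<open>j\<close> is
  represented by both pairs \<open>(i, j)\<close> and \<open>(j, i)\<close>.
\<close>

definition weighted_simple_graph :: "('v::finite \<times> 'v) set \<Rightarrow> real ^ 'v ^ 'v \<Rightarrow> bool" where
  "weighted_simple_graph E W \<longleftrightarrow>
     sym E \<and> irrefl E \<and> transpose W = W \<and> (\<forall>i j. (i, j) \<notin> E \<longrightarrow> W $ i $ j = 0)"

definition graph_shift :: "('v::finite \<times> 'v) set \<Rightarrow> real ^ 'v ^ 'v \<Rightarrow> bool" where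
  "graph_shift E S \<longleftrightarrow> (\<forall>i j. i \<noteq> j \<and> (i, j) \<notin> E \<longrightarrow> S $ i $ j = 0)"

definition shift_invariant :: "nat \<Rightarrow> (nat \<Rightarrow> real ^ 'v ^ 'v) \<Rightarrow> (real ^ 'v::finite) set \<Rightarrow> bool" where
  "shift_invariant d S U \<longleftrightarrow> (\<forall>l\<in>{1..d}. \<forall>x\<in>U. S l *v x \<in> U)"

text \<open>
  An inner product on a subspace \<open>H\<close> is a function on all signals of which only the values
  on \<open>H\<close> matter.
\<close>

definition inner_product_on ::
  "(real ^ 'v::finite) set \<Rightarrow> (real ^ 'v \<Rightarrow> real ^ 'v \<Rightarrow> real) \<Rightarrow> bool" where
  "inner_product_on H ip \<longleftrightarrow>
     (\<forall>x\<in>H. \<forall>y\<in>H. ip x y = ip y x) \<and>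
     (\<forall>x\<in>H. \<forall>y\<in>H. \<forall>z\<in>H. ip (x + y) z = ip x z + ip y z) \<and>
     (\<forall>c. \<forall>x\<in>H. \<forall>y\<in>H. ip (c *\<^sub>R x) y = c * ip x y) \<and>
     (\<forall>x\<in>H. x \<noteq> 0 \<longrightarrow> ip x x > 0)"

definition ip_norm :: "(real ^ 'v \<Rightarrow> real ^ 'v \<Rightarrow> real) \<Rightarrow> real ^ 'v::finite \<Rightarrow> real" where
  "ip_norm ip x = sqrt (ip x x)"

definition hilbert_space_of_signals ::
  "(real ^ 'v::finite) set \<Rightarrow> (real ^ 'v \<Rightarrow> real ^ 'v \<Rightarrow> real) \<Rightarrow> bool" where
  "hilbert_space_of_signals H ip \<longleftrightarrow>
     subspace H \<and> inner_product_on H ip \<and>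
     Metric_space.mcomplete H (\<lambda>x y. ip_norm ip (x - y))"

definition grkhs :: "(real ^ 'v::finite) set \<Rightarrow> (real ^ 'v \<Rightarrow> real ^ 'v \<Rightarrow> real) \<Rightarrow> bool" where
  "grkhs H ip \<longleftrightarrow>
     hilbert_space_of_signals H ip \<and>
     (\<forall>v. \<exists>C>0. \<forall>x\<in>H. \<bar>x $ v\<bar> \<le> C * ip_norm ip x)"

definition reproducing_kernel ::
  "(real ^ 'v::finite) set \<Rightarrow> (real ^ 'v \<Rightarrow> real ^ 'v \<Rightarrow> real) \<Rightarrow> real ^ 'v ^ 'v \<Rightarrow> bool" where
  "reproducing_kernel H ip K \<longleftrightarrow>
     (\<forall>v. column v K \<in> H) \<and> (\<forall>x\<in>H. \<forall>v. x $ v = ip x (column v K))"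

text \<open>Justifies speaking of \<^emph>\<open>the\<close> reproducing kernel.\<close>

lemma reproducing_kernel_unique:
  assumes "grkhs H ip" and K: "reproducing_kernel H ip K" and L: "reproducing_kernel H ip L"
  shows "K = L"
proof -
  have H: "subspace H" and ip: "inner_product_on H ip"
    using assms(1) by (auto simp: grkhs_def hilbert_space_of_signals_def)
  have symH: "ip x y = ip y x" if "x \<in> H" "y \<in> H" for x y
    using ip that unfolding inner_product_on_def by blast
  have addH: "ip (x + y) z = ip x z + ip y z" if "x \<in> H" "y \<in> H" "z \<in> H" for x y z
    using ip that unfolding inner_product_on_def by blast
  have posH: "ip x x > 0" if "x \<in> H" "x \<noteq> 0" for x
    using ip that unfolding inner_product_on_def by blast
  have "column w K = column w L" for w
  proof (rule ccontr)
    define k l where "k = column w K" and "l = column w L"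
    assume "column w K \<noteq> column w L"
    then have ne: "k - l \<noteq> 0"
      by (simp add: k_def l_def)
    have k: "k \<in> H"
      using K unfolding k_def reproducing_kernel_def by blast
    have l: "l \<in> H"
      using L unfolding l_def reproducing_kernel_def by blast
    have d: "k - l \<in> H"
      using subspace_diff[OF H k l] .
    have "(k - l) $ w = ip (k - l) k"
      using K d unfolding k_def reproducing_kernel_def by blast
    moreover have "(k - l) $ w = ip (k - l) l"
      using L d unfolding l_def reproducing_kernel_def by blast
    ultimately have "ip (k - l) k = ip (k - l) l"
      by (rule trans[OF sym])
    moreover have "ip k (k - l) = ip (k - l) (k - l) + ip l (k - l)"
      using addH[OF d l d] unfolding diff_add_cancel .
    ultimately have "ip (k - l) (k - l) = 0"
      using symH[OF d k] symH[OF d l] by linarith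
    with posH[OF d ne] show False
      by linarith
  qed
  then have "column w K $ v = column w L $ v" for v w
    by metis
  then have "K $ v $ w = L $ v $ w" for v w
    unfolding column_def vec_lambda_beta .
  then show ?thesis
    unfolding vec_eq_iff by blast
qed

definition sigrkhs ::
  "nat \<Rightarrow> (nat \<Rightarrow> real ^ 'v ^ 'v) \<Rightarrow>
   (real ^ 'v::finite) set \<Rightarrow> (real ^ 'v \<Rightarrow> real ^ 'v \<Rightarrow> real) \<Rightarrow> bool" where
  "sigrkhs d S H ip \<longleftrightarrow>
     grkhs H ip \<and>
     (\<exists>K. reproducing_kernel H ip K \<and> (\<forall>l\<in>{1..d}. K ** S l = S l ** K))"

end

theory Submission
  imports Defs
begin

text \<open>
  For the standard inner product the reproducing kernel of \<open>U\<close> is the orthogonal projection \<open>P\<close>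
  onto \<open>U\<close>. If \<open>P\<close> commutes with \<open>S\<close>, then \<open>S x = S (P x) = P (S x) \<in> U\<close> for \<open>x \<in> U\<close>.
  Conversely, invariance of \<open>U\<close> under \<open>S\<close> means \<open>P S P = S P\<close>; transposing, with \<open>P\<close> and \<open>S\<close>
  symmetric, gives \<open>P S P = P S\<close>, hence \<open>S P = P S\<close>.
\<close>

lemma ip_norm_inner: "ip_norm (\<bullet>) x = norm x"
  by (simp add: ip_norm_def norm_eq_sqrt_inner)

text \<open>Completeness passes from the whole space to a closed subset; this links the type-class
  view of completeness to the set-based \<open>Metric_space.mcomplete\<close> in the definition of a
  Hilbert space of signals.\<close>

lemma mcomplete_dist_closed:
  fixes U :: "'a::complete_space set"
  assumes "closed U"
  shows "Metric_space.mcomplete U dist"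
proof -
  have "Submetric UNIV dist U"
    by unfold_locales auto
  moreover have "Metric_space.mcomplete (UNIV :: 'a set) dist"
    by (simp add: complete_UNIV)
  ultimately show ?thesis
    using Submetric.closedin_mcomplete_imp_mcomplete assms closedin_mtopology_eq_closed by metis
qed

text \<open>Completeness holds because subspaces of a finite-dimensional space are closed. A
  coordinate is bounded by the Euclidean norm, so \<open>C = 1\<close> serves at every
  vertex.\<close>

lemma grkhs_inner:
  fixes U :: "(real ^ 'v::finite) set"
  assumes "subspace U"
  shows "grkhs U (\<bullet>)"
proof -
  have "inner_product_on U (\<bullet>)"
    by (simp add: inner_product_on_def inner_commute inner_add_right)
  moreover have "(\<lambda>x y :: real ^ 'v. ip_norm (\<bullet>) (x - y)) = dist"
    by (simp add: fun_eq_iff ip_norm_inner dist_norm)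
  ultimately have "hilbert_space_of_signals U (\<bullet>)"
    using assms mcomplete_dist_closed[OF closed_subspace[OF assms]]
    by (simp add: hilbert_space_of_signals_def)
  moreover have "\<bar>x $ v\<bar> \<le> 1 * ip_norm (\<bullet>) x" for x :: "real ^ 'v" and v
    by (simp add: ip_norm_inner component_le_norm_cart)
  ultimately show ?thesis
    unfolding grkhs_def by (meson zero_less_one)
qed

text \<open>Evaluation at \<open>v\<close> is the inner product with \<open>axis v 1\<close>; on
  \<open>U\<close> only the orthogonal projection of that vector onto \<open>U\<close> matters, and
  this projection becomes column \<open>v\<close> of the kernel.\<close>

lemma reproducing_kernel_inner_exists:
  fixes U :: "(real ^ 'v::finite) set"
  assumes "subspace U"
  obtains K where "reproducing_kernel U (\<bullet>) K"
proof -
  have "\<exists>y\<in>U. \<forall>x\<in>U. x $ v = x \<bullet> y" for v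
  proof -
    obtain y z where "y \<in> span U" and z: "\<And>w. w \<in> span U \<Longrightarrow> orthogonal z w"
      and eq: "axis v 1 = y + z"
      using orthogonal_subspace_decomp_exists by metis
    moreover have "x $ v = x \<bullet> y" if "x \<in> U" for x
    proof -
      have "x $ v = x \<bullet> (y + z)"
        unfolding eq[symmetric] by (simp add: inner_axis)
      moreover have "x \<bullet> z = 0"
        using z[of x] that by (simp add: span_base orthogonal_def inner_commute)
      ultimately show ?thesis
        by (simp add: inner_add_right)
    qed
    ultimately show ?thesis
      using assms by (metis span_eq_iff)
  qed
  then obtain k where "\<And>v. k v \<in> U" "\<And>v x. x \<in> U \<Longrightarrow> x $ v = x \<bullet> k v"
    by metis
  moreover have "column v (\<chi> i j. k j $ i) = k v" for v
    by (simp add: column_def)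
  ultimately have "reproducing_kernel U (\<bullet>) (\<chi> i j. k j $ i)"
    by (simp add: reproducing_kernel_def)
  then show thesis
    by (rule that)
qed

text \<open>The reproducing property applied to the columns themselves shows that \<open>K\<close>
  is their Gram matrix.\<close>

lemma reproducing_kernel_inner_transpose:
  assumes "reproducing_kernel U (\<bullet>) K"
  shows "transpose K = K"
proof -
  have "K $ i $ j = column j K \<bullet> column i K" for i j
    using assms unfolding reproducing_kernel_def by (metis column_def vec_lambda_beta)
  then show ?thesis
    by (simp add: transpose_def vec_eq_iff inner_commute)
qed

text \<open>The product is a linear combination of the columns of \<open>K\<close>, which lie in
  \<open>U\<close>.\<close>

lemma reproducing_kernel_mult_in:
  assumes "reproducing_kernel U ip K" and "subspace U"
  shows "K *v x \<in> U"
  using assms unfolding reproducing_kernel_def matrix_mult_sum scalar_mult_eq_scaleR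
  by (simp add: subspace_sum subspace_scale)

lemma reproducing_kernel_inner_mult:
  assumes "reproducing_kernel U (\<bullet>) K" and "x \<in> U"
  shows "K *v x = x"
proof -
  \<comment> \<open>The reproducing property speaks of columns, hence directly of
    \<open>transpose K\<close>; symmetry then carries the result over to \<open>K\<close>.\<close>
  have "(transpose K *v x) $ v = x \<bullet> column v K" for v
    by (simp add: matrix_vector_mult_def transpose_def column_def inner_vec_def mult.commute)
  then have "transpose K *v x = x"
    using assms by (simp add: reproducing_kernel_def vec_eq_iff)
  then show ?thesis
    by (simp add: reproducing_kernel_inner_transpose[OF assms(1)])
qed

lemma invariant_iff_commutes_reproducing_kernel:
  fixes A :: "real ^ 'v ^ 'v::finite"
  assumes K: "reproducing_kernel U (\<bullet>) K" and U: "subspace U" and A: "transpose A = A"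
  shows "(\<forall>x\<in>U. A *v x \<in> U) \<longleftrightarrow> K ** A = A ** K"
proof
  assume inv: "\<forall>x\<in>U. A *v x \<in> U"
  have "K *v (A *v (K *v x)) = A *v (K *v x)" for x
    using reproducing_kernel_mult_in[OF K U] inv reproducing_kernel_inner_mult[OF K] by blast
  then have KAK: "K ** A ** K = A ** K"
    by (simp add: matrix_eq flip: matrix_vector_mul_assoc)
  then have "transpose (K ** A ** K) = transpose (A ** K)"
    by simp
  then have "K ** A ** K = K ** A"
    by (simp add: matrix_transpose_mul A reproducing_kernel_inner_transpose[OF K] matrix_mul_assoc)
  with KAK show "K ** A = A ** K"
    by simp
next
  assume comm: "K ** A = A ** K"
  show "\<forall>x\<in>U. A *v x \<in> U"
  proof
    fix x assume "x \<in> U"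
    then have "A *v x = (A ** K) *v x"
      by (simp add: reproducing_kernel_inner_mult[OF K] flip: matrix_vector_mul_assoc)
    also have "\<dots> = K *v (A *v x)"
      by (simp add: matrix_vector_mul_assoc comm)
    finally show "A *v x \<in> U"
      using reproducing_kernel_mult_in[OF K U] by metis
  qed
qed

theorem theorem5p1:
  fixes E :: "('v::finite \<times> 'v) set"
    and W :: "real ^ 'v ^ 'v"
    and d :: nat
    and S :: "nat \<Rightarrow> real ^ 'v ^ 'v"
    and U :: "(real ^ 'v) set"
  assumes "CARD('v) \<ge> 2"
    and "weighted_simple_graph E W"
    and "\<And>l. l \<in> {1..d} \<Longrightarrow> graph_shift E (S l)"
    and "\<And>l. l \<in> {1..d} \<Longrightarrow> transpose (S l) = S l"
    and "\<And>l m. l \<in> {1..d} \<Longrightarrow> m \<in> {1..d} \<Longrightarrow> S l ** S m = S m ** S l"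
    and "subspace U"
  shows "shift_invariant d S U \<longleftrightarrow> sigrkhs d S U (\<bullet>)"
proof -
  \<comment> \<open>Stated for every kernel \<open>K\<close>: the direction from right to left takes
    the kernel provided by \<open>sigrkhs\<close>, the other one the kernel obtained below.\<close>
  have "shift_invariant d S U \<longleftrightarrow> (\<forall>l\<in>{1..d}. K ** S l = S l ** K)"
    if "reproducing_kernel U (\<bullet>) K" for K
    unfolding shift_invariant_def
    using invariant_iff_commutes_reproducing_kernel[OF that assms(6) assms(4)] by blast
  moreover obtain K where "reproducing_kernel U (\<bullet>) K"
    using reproducing_kernel_inner_exists[OF assms(6)] .
  ultimately show ?thesis
    unfolding sigrkhs_def using grkhs_inner[OF assms(6)] by blast
qed

end
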